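(* Let $A$ be an associative algebra, $M$ an $A$-bimodule and $P:M\to A$ a relative averaging operator. Then the maps $\Theta_n:CY^n(M,A)\to CY^{n+1}(M_P,M_P)$, $n\ge0$, defined in the context induce a morphism (a linear map in each degree) $$\Theta_\bullet:H^\bullet_P(M,A)\to H^{\bullet+1}_{\mathrm{Diass}}(M_P,M_P)$$ from the cohomology of the relative averaging operator $P$ to the cohomology of the induced diassociative algebra $M_P$ with coefficients in the adjoint representation.
   Context: Everything is over a field $\mathbf k$ of characteristic $0$. Trees. $Y_n$ ($n\ge 1$) is the set of planar binary trees with $n$ trivalent vertices, one root and $n+1$ leaves labelled $0,1,\dots,n$ from left to right; $Y_0=\{|\}$. For $y_1\in Y_m,y_2\in Y_n$, the grafting $y_1\vee y_2\in Y_{m+n+1}$ joins the roots of $y_1$ (left) and $y_2$ (right) to a new vertex with a new root. $Y_2=\{y_\dashv,y_\vdash\}$, $y_\dashv=|\vee(|\vee|)$, $y_\vdash=(|\vee|)\vee|$. $d_i:Y_n\to Y_{n-1}$ deletes the $i$-th leaf. For $m,n\ge1$, $1\le i\le m$: $R_0^{m;i,n}:Y_{m+n-1}\to Y_m$ deletes the leaves labelled $i,\dots,i+n-2$, and $R_i^{m;i,n}:Y_{m+n-1}\to Y_n$ deletes the leaves labelled $0,\dots,i-2$ and $i+n,\dots,m+n-1$ (labels refer to the original tree). For $y\in Y_n$, $n\ge1$, symbols $\star_i^y\in\{\dashv,\vdash\}$: $\star_0^y=\dashv$ if $y=|\vee y_1$ for some $y_1\in Y_{n-1}$ and $\vdash$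 otherwise; for $1\le i\le n-1$, $\star_i^y=\dashv$ if the $i$-th leaf is oriented like $\backslash$ (it is a left child of its vertex) and $\vdash$ if it is oriented like $/$ (a right child); $\star_n^y=\vdash$ if $y=y_1\vee|$ for some $y_1\in Y_{n-1}$ and $\dashv$ otherwise. For vector spaces $D,D'$ put $CY^n(D,D')=\mathrm{Hom}(\mathbf k[Y_n]\otimes D^{\otimes n},D')$. For $f\in CY^m(D,D)$, $g\in CY^n(D,D)$, $m,n\geq 1$, $$(f\circ_i g)(y;a_1,\dots,a_{m+n-1})=f\big(R_0^{m;i,n}(y);a_1,\dots,a_{i-1},g(R_i^{m;i,n}(y);a_i,\dots,a_{i+n-1}),a_{i+n},\dots,a_{m+n-1}\big),$$ $$[f,g]_{\mathsf{MM}}=\sum_{i=1}^m(-1)^{(i-1)(n-1)}f\circ_i g-(-1)^{(m-1)(n-1)}\sum_{i=1}^n(-1)^{(i-1)(m-1)}g\circ_i f .$$ Relative averaging operator: a linear map $P:M\to A$ with $P(u)\cdot P(v)=P(P(u)\cdot_M v)=P(u\cdot_M P(v))$ for all $u,v\in M$, where $\cdot_M$ denotes both $A$-actions on $M$; $P$ is viewed in $CY^1(M,A)$. Cohomology of $P$. Let $\Delta\in CY^2(A\oplus M,A\oplus M)$ be $\Delta(y_\dashv;(a,u),(b,v))=(a\cdot b,u\cdot_M b)$, $\Delta(y_\vdash;(a,u),(b,v))=(a\cdot b,a\cdot_M v)$. Regard $CY^n(M,A)\subset CY^n(A\oplus M,A\oplus M)$ ($n\ge1$) by extension by zero. For $f\in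 CY^m(M,A)$, $g\in CY^n(M,A)$, $m,n\ge1$, set $\llbracket f,g\rrbracket=(-1)^m[[\Delta,f]_{\mathsf{MM}},g]_{\mathsf{MM}}\in CY^{m+n}(M,A)$; for $a\in A=CY^0(M,A)$ set $$\llbracket P,a\rrbracket(|\vee|;u)=P(a\cdot_M u-u\cdot_M a)+P(u)\cdot a-a\cdot P(u).$$ Then $d_P=\llbracket P,-\rrbracket:CY^n(M,A)\to CY^{n+1}(M,A)$, $n\ge0$, satisfies $d_P^2=0$, and $H^n_P(M,A)$ is the $n$-th cohomology of $\{CY^\bullet(M,A),d_P\}$. Induced diassociative algebra. $M_P$ is $M$ with $u\dashv_P v=u\cdot_M P(v)$ and $u\vdash_P v=P(u)\cdot_M v$. $H^n_{\mathrm{Diass}}(M_P,M_P)$ is the cohomology of $\{CY^\bullet(M_P,M_P),\delta_{\mathrm{Diass}}\}$ ($CY^n(M_P,M_P)=CY^n(M,M)$, $n\ge 0$), where $$\delta_{\mathrm{Diass}}(f)(y;u_1,\dots,u_{n+1})=u_1\star_0^y f(d_0y;u_2,\dots,u_{n+1})+\sum_{i=1}^n(-1)^i f(d_iy;u_1,\dots,u_i\star_i^y u_{i+1},\dots,u_{n+1})+(-1)^{n+1}f(d_{n+1}y;u_1,\dots,u_n)\star_{n+1}^y u_{n+1},$$ with $\dashv,\vdash$ meaning $\dashv_P,\vdash_P$. The maps $\Theta_n$. For $n\ge1$, $f\in CY^n(M,A)$, $y\in Y_{n+1}$, $u_1,\dots,u_{n+1}\in M$: $\Theta_n(f)(y;u_1,\dots,u_{n+1})$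 equals $(-1)^{n+1}u_1\cdot_M f(y_1;u_2,\dots,u_{n+1})$ if $y=|\vee y_1$ with $y_1\in Y_n$; equals $f(y_1;u_1,\dots,u_n)\cdot_M u_{n+1}$ if $y=y_1\vee|$ with $y_1\in Y_n$; and is $0$ otherwise. For $n=0$ and $a\in A$: $\Theta_0(a)(|\vee|;u)=a\cdot_M u-u\cdot_M a$. *)

theory Defs
  imports
    Complex_Main
    "HOL-Library.Function_Algebras"
    "HOL-Library.Product_Plus"
    "HOL-Library.Set_Algebras"
begin

text \<open>
  A vector space over the field \<^typ>\<open>'k\<close> is an abelian group type together with a scalar
  multiplication \<open>s\<close> satisfying \<^const>\<open>vector_space\<close>. Algebras need not be unital.
\<close>

locale assoc_algebra =
  fixes sA :: "'k::field_char_0 \<Rightarrow> 'a::ab_group_add \<Rightarrow> 'a"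
    and mA :: "'a \<Rightarrow> 'a \<Rightarrow> 'a"
  assumes vector_space_A: "vector_space sA"
    and mult_linear_right: "\<And>a. Vector_Spaces.linear sA sA (\<lambda>b. mA a b)"
    and mult_linear_left: "\<And>b. Vector_Spaces.linear sA sA (\<lambda>a. mA a b)"
    and mult_assoc: "\<And>a b c. mA (mA a b) c = mA a (mA b c)"

locale algebra_bimodule = assoc_algebra sA mA
  for sA :: "'k::field_char_0 \<Rightarrow> 'a::ab_group_add \<Rightarrow> 'a"
    and mA :: "'a \<Rightarrow> 'a \<Rightarrow> 'a" +
  fixes sM :: "'k \<Rightarrow> 'm::ab_group_add \<Rightarrow> 'm"
    and lact :: "'a \<Rightarrow> 'm \<Rightarrow> 'm"
    and ract :: "'m \<Rightarrow> 'a \<Rightarrow> 'm"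
  assumes vector_space_M: "vector_space sM"
    and lact_linear_right: "\<And>a. Vector_Spaces.linear sM sM (\<lambda>u. lact a u)"
    and lact_linear_left: "\<And>u. Vector_Spaces.linear sA sM (\<lambda>a. lact a u)"
    and ract_linear_right: "\<And>u. Vector_Spaces.linear sA sM (\<lambda>a. ract u a)"
    and ract_linear_left: "\<And>a. Vector_Spaces.linear sM sM (\<lambda>u. ract u a)"
    and lact_lact: "\<And>a b u. lact (mA a b) u = lact a (lact b u)"
    and ract_ract: "\<And>u a b. ract u (mA a b) = ract (ract u a) b"
    and lact_ract: "\<And>a u b. ract (lact a u) b = lact a (ract u b)"

locale rel_averaging_operator = algebra_bimodule sA mA sM lact ract
  for sA :: "'k::field_char_0 \<Rightarrow> 'a::ab_group_add \<Rightarrow> 'a"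
    and mA :: "'a \<Rightarrow> 'a \<Rightarrow> 'a"
    and sM :: "'k \<Rightarrow> 'm::ab_group_add \<Rightarrow> 'm"
    and lact :: "'a \<Rightarrow> 'm \<Rightarrow> 'm"
    and ract :: "'m \<Rightarrow> 'a \<Rightarrow> 'm" +
  fixes P :: "'m \<Rightarrow> 'a"
  assumes P_linear: "Vector_Spaces.linear sM sA P"
    and P_lact: "\<And>u v. mA (P u) (P v) = P (lact (P u) v)"
    and P_ract: "\<And>u v. mA (P u) (P v) = P (ract u (P v))"

datatype ytree = Leaf | Graft ytree ytree

fun nodes :: "ytree \<Rightarrow> nat" where
  "nodes Leaf = 0"
| "nodes (Graft l r) = nodes l + nodes r + 1"

fun leaves :: "ytree \<Rightarrow> nat" where
  "leaves Leaf = 1"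
| "leaves (Graft l r) = leaves l + leaves r"

definition Y :: "nat \<Rightarrow> ytree set" where
  "Y n = {y. nodes y = n}"

definition y_dashv :: ytree where
  "y_dashv = Graft Leaf (Graft Leaf Leaf)"

definition y_vdash :: ytree where
  "y_vdash = Graft (Graft Leaf Leaf) Leaf"

text \<open>
  \<open>del i y\<close> is \<open>d\<^sub>i y\<close>. Leaves are numbered from \<open>0\<close>, left to right; in \<open>Graft l r\<close> leaf \<open>i\<close> is
  leaf \<open>i - leaves l\<close> of \<open>r\<close> if \<open>i \<ge> leaves l\<close>. The value at \<open>Leaf\<close> is never used.
\<close>

fun del :: "nat \<Rightarrow> ytree \<Rightarrow> ytree" where
  "del i Leaf = Leaf"
| "del i (Graft l r) =
     (if i < leaves l then (if l = Leaf then r else Graft (del i l) r)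
      else (if r = Leaf then l else Graft l (del (i - leaves l) r)))"

text \<open>
  Deletion of all leaves in a strictly increasing list of labels of the original tree:
  \<^const>\<open>foldr\<close> removes the largest label first, which leaves the smaller labels unchanged. \<open>R_outer m i n\<close> is
  \<open>R\<^sub>0\<close> and \<open>R_inner m i n\<close> is \<open>R\<^sub>i\<close> (with superscript \<open>m;i,n\<close>).
\<close>

definition del_leaves :: "nat list \<Rightarrow> ytree \<Rightarrow> ytree" where
  "del_leaves is y = foldr del is y"

definition R_outer :: "nat \<Rightarrow> nat \<Rightarrow> nat \<Rightarrow> ytree \<Rightarrow> ytree" where
  "R_outer m i n y = del_leaves [i..<i + n - 1] y"

definition R_inner :: "nat \<Rightarrow> nat \<Rightarrow> nat \<Rightarrow> ytree \<Rightarrow> ytree" where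
  "R_inner m i n y = del_leaves ([0..<i - 1] @ [i + n..<m + n]) y"

fun is_left_child :: "nat \<Rightarrow> ytree \<Rightarrow> bool" where
  "is_left_child i Leaf = False"
| "is_left_child i (Graft l r) =
     (if i < leaves l then l = Leaf \<or> is_left_child i l
      else r \<noteq> Leaf \<and> is_left_child (i - leaves l) r)"

datatype dsym = Dashv | Vdash

definition star :: "nat \<Rightarrow> ytree \<Rightarrow> dsym" where
  "star i y =
     (if i = 0 then (if \<exists>y1. y = Graft Leaf y1 then Dashv else Vdash)
      else if i = nodes y then (if \<exists>y1. y = Graft y1 Leaf then Vdash else Dashv)
      else (if is_left_child i y then Dashv else Vdash))"

text \<open>
  \<open>CY\<^sup>n(D,D')\<close>: a linear map on \<open>k[Y\<^sub>n] \<otimes> D\<^sup>\<otimes>\<^sup>n\<close> is given by a multilinear map of \<open>n\<close> arguments for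
  every tree in \<open>Y\<^sub>n\<close>. Cochains vanish outside their domain, so that equality and the pointwise
  operations of \<^theory>\<open>HOL-Library.Function_Algebras\<close> are those of \<open>CY\<^sup>n\<close>.
  An element \<open>f\<close> of \<open>CY\<^sup>0(D,D')\<close> is the same as the vector \<open>f Leaf []\<close> of \<open>D'\<close>.
\<close>

type_synonym ('d, 'e) cochain = "ytree \<Rightarrow> 'd list \<Rightarrow> 'e"

definition cochains ::
  "('k::field_char_0 \<Rightarrow> 'd::ab_group_add \<Rightarrow> 'd) \<Rightarrow> ('k \<Rightarrow> 'e::ab_group_add \<Rightarrow> 'e) \<Rightarrow> nat
     \<Rightarrow> ('d, 'e) cochain set" where
  "cochains sD sE n =
     {f. (\<forall>y us. \<not> (y \<in> Y n \<and> length us = n) \<longrightarrow> f y us = 0) \<and>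
         (\<forall>y us. y \<in> Y n \<and> length us = n \<longrightarrow>
            (\<forall>i<n. Vector_Spaces.linear sD sE (\<lambda>x. f y (us[i := x]))))}"

definition cochain_scale :: "('k \<Rightarrow> 'e \<Rightarrow> 'e) \<Rightarrow> 'k \<Rightarrow> ('d, 'e) cochain \<Rightarrow> ('d, 'e) cochain" where
  "cochain_scale s c f = (\<lambda>y us. s c (f y us))"

definition circ_i ::
  "nat \<Rightarrow> nat \<Rightarrow> nat \<Rightarrow> ('d, 'd) cochain \<Rightarrow> ('d, 'd) cochain \<Rightarrow> ('d::zero, 'd) cochain" where
  "circ_i m n i f g = (\<lambda>y us.
     if y \<in> Y (m + n - 1) \<and> length us = m + n - 1
     then f (R_outer m i n y)
            (take (i - 1) us
             @ [g (R_inner m i n y) (take n (drop (i - 1) us))]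
             @ drop (i + n - 1) us)
     else 0)"

definition MM_bracket ::
  "('k::field_char_0 \<Rightarrow> 'd::ab_group_add \<Rightarrow> 'd) \<Rightarrow> nat \<Rightarrow> nat
     \<Rightarrow> ('d, 'd) cochain \<Rightarrow> ('d, 'd) cochain \<Rightarrow> ('d, 'd) cochain" where
  "MM_bracket s m n f g =
     (\<Sum>i = 1..m. cochain_scale s ((-1) ^ ((i - 1) * (n - 1))) (circ_i m n i f g))
     - cochain_scale s ((-1) ^ ((m - 1) * (n - 1)))
         (\<Sum>i = 1..n. cochain_scale s ((-1) ^ ((i - 1) * (m - 1))) (circ_i n m i g f))"

definition sum_scale ::
  "('k \<Rightarrow> 'a \<Rightarrow> 'a) \<Rightarrow> ('k \<Rightarrow> 'm \<Rightarrow> 'm) \<Rightarrow> 'k \<Rightarrow> 'a \<times> 'm \<Rightarrow> 'a \<times> 'm" where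
  "sum_scale sA sM c x = (sA c (fst x), sM c (snd x))"

definition Delta ::
  "('a \<Rightarrow> 'a \<Rightarrow> 'a) \<Rightarrow> ('a \<Rightarrow> 'm \<Rightarrow> 'm) \<Rightarrow> ('m \<Rightarrow> 'a \<Rightarrow> 'm)
     \<Rightarrow> ('a::zero \<times> 'm::zero, 'a \<times> 'm) cochain" where
  "Delta mA lact ract = (\<lambda>y xs.
     if length xs = 2 \<and> y = y_dashv
       then (mA (fst (xs ! 0)) (fst (xs ! 1)), ract (snd (xs ! 0)) (fst (xs ! 1)))
     else if length xs = 2 \<and> y = y_vdash
       then (mA (fst (xs ! 0)) (fst (xs ! 1)), lact (fst (xs ! 0)) (snd (xs ! 1)))
     else 0)"

text \<open>
  The inclusion \<open>CY\<^sup>n(M,A) \<subseteq> CY\<^sup>n(A \<oplus> M, A \<oplus> M)\<close> and its left inverse. The latter is only applied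
  to cochains that lie in the image of the inclusion.
\<close>

definition ext_cochain :: "('m, 'a) cochain \<Rightarrow> ('a \<times> 'm, 'a \<times> 'm::zero) cochain" where
  "ext_cochain f = (\<lambda>y xs. (f y (map snd xs), 0))"

definition restrict_cochain :: "('a::zero \<times> 'm, 'a \<times> 'm) cochain \<Rightarrow> ('m, 'a) cochain" where
  "restrict_cochain F = (\<lambda>y us. fst (F y (map (\<lambda>u. (0, u)) us)))"

definition derived_bracket ::
  "('k::field_char_0 \<Rightarrow> 'a::ab_group_add \<Rightarrow> 'a) \<Rightarrow> ('a \<Rightarrow> 'a \<Rightarrow> 'a)
     \<Rightarrow> ('k \<Rightarrow> 'm::ab_group_add \<Rightarrow> 'm) \<Rightarrow> ('a \<Rightarrow> 'm \<Rightarrow> 'm) \<Rightarrow> ('m \<Rightarrow> 'a \<Rightarrow> 'm)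
     \<Rightarrow> nat \<Rightarrow> nat \<Rightarrow> ('m, 'a) cochain \<Rightarrow> ('m, 'a) cochain \<Rightarrow> ('m, 'a) cochain" where
  "derived_bracket sA mA sM lact ract m n f g =
     cochain_scale sA ((-1) ^ m)
       (restrict_cochain
         (MM_bracket (sum_scale sA sM) (m + 1) n
            (MM_bracket (sum_scale sA sM) 2 m (Delta mA lact ract) (ext_cochain f))
            (ext_cochain g)))"

definition cochain1 :: "('m \<Rightarrow> 'a) \<Rightarrow> ('m, 'a::zero) cochain" where
  "cochain1 P = (\<lambda>y us. if y = Graft Leaf Leaf \<and> length us = 1 then P (us ! 0) else 0)"

definition d_P ::
  "('k::field_char_0 \<Rightarrow> 'a::ab_group_add \<Rightarrow> 'a) \<Rightarrow> ('a \<Rightarrow> 'a \<Rightarrow> 'a)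
     \<Rightarrow> ('k \<Rightarrow> 'm::ab_group_add \<Rightarrow> 'm) \<Rightarrow> ('a \<Rightarrow> 'm \<Rightarrow> 'm) \<Rightarrow> ('m \<Rightarrow> 'a \<Rightarrow> 'm) \<Rightarrow> ('m \<Rightarrow> 'a)
     \<Rightarrow> nat \<Rightarrow> ('m, 'a) cochain \<Rightarrow> ('m, 'a) cochain" where
  "d_P sA mA sM lact ract P n f =
     (if n = 0
      then (let a = f Leaf []
            in cochain1 (\<lambda>u. P (lact a u - ract u a) + mA (P u) a - mA a (P u)))
      else derived_bracket sA mA sM lact ract 1 n (cochain1 P) f)"

text \<open>\<open>op Dashv\<close> and \<open>op Vdash\<close> are the two products; the coefficients are the adjoint ones.\<close>

definition delta_Diass ::
  "('k::field_char_0 \<Rightarrow> 'm::ab_group_add \<Rightarrow> 'm) \<Rightarrow> (dsym \<Rightarrow> 'm \<Rightarrow> 'm \<Rightarrow> 'm)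
     \<Rightarrow> nat \<Rightarrow> ('m, 'm) cochain \<Rightarrow> ('m, 'm) cochain" where
  "delta_Diass s op n f = (\<lambda>y us.
     if y \<in> Y (n + 1) \<and> length us = n + 1
     then op (star 0 y) (us ! 0) (f (del 0 y) (drop 1 us))
        + (\<Sum>i = 1..n. s ((-1) ^ i)
             (f (del i y)
                (take (i - 1) us @ [op (star i y) (us ! (i - 1)) (us ! i)] @ drop (i + 1) us)))
        + s ((-1) ^ (n + 1)) (op (star (n + 1) y) (f (del (n + 1) y) (take n us)) (us ! n))
     else 0)"

definition induced_op ::
  "('a \<Rightarrow> 'm \<Rightarrow> 'm) \<Rightarrow> ('m \<Rightarrow> 'a \<Rightarrow> 'm) \<Rightarrow> ('m \<Rightarrow> 'a) \<Rightarrow> dsym \<Rightarrow> 'm \<Rightarrow> 'm \<Rightarrow> 'm" where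
  "induced_op lact ract P d u v =
     (case d of Dashv \<Rightarrow> ract u (P v) | Vdash \<Rightarrow> lact (P u) v)"

definition Theta ::
  "('k::field_char_0 \<Rightarrow> 'm::ab_group_add \<Rightarrow> 'm) \<Rightarrow> ('a \<Rightarrow> 'm \<Rightarrow> 'm) \<Rightarrow> ('m \<Rightarrow> 'a \<Rightarrow> 'm)
     \<Rightarrow> nat \<Rightarrow> ('m, 'a) cochain \<Rightarrow> ('m, 'm) cochain" where
  "Theta sM lact ract n f =
     (if n = 0
      then (let a = f Leaf [] in cochain1 (\<lambda>u. lact a u - ract u a))
      else (\<lambda>y us.
        if y \<in> Y (n + 1) \<and> length us = n + 1
        then (case y of
                Graft Leaf y1 \<Rightarrow> sM ((-1) ^ (n + 1)) (ract (us ! 0) (f y1 (drop 1 us)))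
              | Graft y1 Leaf \<Rightarrow> lact (f y1 (take n us)) (us ! n)
              | _ \<Rightarrow> 0)
        else 0))"

text \<open>
  A complex is a family of spaces \<open>C n\<close> with maps \<open>d n\<close> from \<open>C n\<close> to \<open>C (n + 1)\<close>, \<open>n \<ge> 0\<close>.
  The cohomology class of \<open>f\<close> is the coset \<open>f +o coboundaries C d n\<close>.
\<close>

definition cocycles :: "(nat \<Rightarrow> 'v set) \<Rightarrow> (nat \<Rightarrow> 'v \<Rightarrow> 'v) \<Rightarrow> nat \<Rightarrow> 'v::ab_group_add set" where
  "cocycles C d n = {f \<in> C n. d n f = 0}"

definition coboundaries :: "(nat \<Rightarrow> 'v set) \<Rightarrow> (nat \<Rightarrow> 'v \<Rightarrow> 'v) \<Rightarrow> nat \<Rightarrow> 'v::ab_group_add set" where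
  "coboundaries C d n = (case n of 0 \<Rightarrow> {0} | Suc k \<Rightarrow> d k ` C k)"

definition cohomology ::
  "(nat \<Rightarrow> 'v set) \<Rightarrow> (nat \<Rightarrow> 'v \<Rightarrow> 'v) \<Rightarrow> nat \<Rightarrow> 'v::ab_group_add set set" where
  "cohomology C d n = (\<lambda>f. f +o coboundaries C d n) ` cocycles C d n"

text \<open>
  Vector space operations on cosets of a subspace \<open>B\<close>: addition is the setwise \<open>+\<close> of
  \<^theory>\<open>HOL-Library.Set_Algebras\<close>; in \<open>quot_scale\<close> the summand \<open>B\<close> is needed for the scalar \<open>0\<close>.
  The two lemmas show that these are the usual operations on representatives.
\<close>

definition quot_scale ::
  "('k \<Rightarrow> 'v \<Rightarrow> 'v) \<Rightarrow> 'v::ab_group_add set \<Rightarrow> 'k \<Rightarrow> 'v set \<Rightarrow> 'v set" where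
  "quot_scale s B c X = s c ` X + B"

lemma coset_plus_coset:
  fixes B :: "'v::ab_group_add set"
  assumes "0 \<in> B" and "\<And>x y. x \<in> B \<Longrightarrow> y \<in> B \<Longrightarrow> x + y \<in> B"
  shows "(f +o B) + (g +o B) = (f + g) +o B"
proof -
  have "B + B = B"
    using assms by (force simp: set_plus_def)
  then show ?thesis
    by (simp add: set_plus_rearrange)
qed

lemma quot_scale_coset:
  fixes B :: "'v::ab_group_add set"
  assumes "0 \<in> B" and "\<And>x y. x \<in> B \<Longrightarrow> y \<in> B \<Longrightarrow> x + y \<in> B" and "\<And>x. x \<in> B \<Longrightarrow> s c x \<in> B"
    and "\<And>x y. s c (x + y) = s c x + s c y"
  shows "quot_scale s B c (f +o B) = s c f +o B"
proof
  show "quot_scale s B c (f +o B) \<subseteq> s c f +o B"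
    using assms by (auto simp: quot_scale_def elt_set_plus_def set_plus_def add.assoc)
  show "s c f +o B \<subseteq> quot_scale s B c (f +o B)"
  proof
    fix x assume "x \<in> s c f +o B"
    then obtain b where "b \<in> B" "x = s c f + b"
      by (auto simp: elt_set_plus_def)
    moreover have "f \<in> f +o B"
      using assms(1) by (auto simp: elt_set_plus_def)
    ultimately show "x \<in> quot_scale s B c (f +o B)"
      by (auto simp: quot_scale_def set_plus_def)
  qed
qed

definition linear_between ::
  "('k \<Rightarrow> 'v \<Rightarrow> 'v) \<Rightarrow> 'v::plus set \<Rightarrow> ('k \<Rightarrow> 'w \<Rightarrow> 'w) \<Rightarrow> 'w::plus set \<Rightarrow> ('v \<Rightarrow> 'w) \<Rightarrow> bool" where
  "linear_between sV V sW W F \<longleftrightarrow>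
     (\<forall>x\<in>V. F x \<in> W) \<and>
     (\<forall>x\<in>V. \<forall>y\<in>V. F (x + y) = F x + F y) \<and>
     (\<forall>c. \<forall>x\<in>V. F (sV c x) = sW c (F x))"

end

theory Submission
  imports Defs
begin

text \<open>
  Expanding the brackets shows that \<open>d\<^sub>P f\<close> is \<open>(-1)\<^sup>n\<close> times the diassociative differential of \<open>f\<close>
  with values in \<open>A\<close>, regarded as a bimodule over \<open>M\<^sub>P\<close> through \<open>P\<close>, plus the correction term
  \<open>P \<circ> \<Theta>\<^sub>n f\<close>. Comparing the trees \<open>| \<or> y\<^sub>1\<close>, \<open>y\<^sub>1 \<or> |\<close> and \<open>y\<^sub>1 \<or> y\<^sub>2\<close> then gives
  \<open>\<delta> \<Theta>\<^sub>n = (-1)\<^sup>n \<Theta>\<^sub>n\<^sub>+\<^sub>1 d\<^sub>P\<close> in every degree: on the first two kinds of trees the correction term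
  comes from an outermost term of \<open>\<delta>\<close>, and on the third kind the nonzero terms cancel in pairs,
  because \<open>\<Theta>\<^sub>n f\<close> vanishes unless one of the two subtrees at the root is a leaf.
\<close>

subsection \<open>Deleting leaves of planar binary trees\<close>

lemma leaves_eq_nodes: "leaves y = nodes y + 1"
  by (induction y) auto

lemma nodes_eq_0_iff [simp]: "nodes y = 0 \<longleftrightarrow> y = Leaf"
  by (cases y) auto

lemma Suc_nodes_diff_1 [simp]: "y \<noteq> Leaf \<Longrightarrow> Suc (nodes y - Suc 0) = nodes y"
  by (cases y) auto

lemma nodes_eq_1_iff: "nodes y = Suc 0 \<longleftrightarrow> y = Graft Leaf Leaf"
  by (cases y) auto

lemma nodes_eq_2_iff: "nodes y = 2 \<longleftrightarrow> y = y_dashv \<or> y = y_vdash"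
proof (cases y)
  case (Graft l r)
  then show ?thesis
    by (cases "nodes l") (auto simp: y_dashv_def y_vdash_def nodes_eq_1_iff numeral_2_eq_2)
qed (auto simp: y_dashv_def y_vdash_def)

lemma nodes_del [simp]: "i \<le> nodes y \<Longrightarrow> nodes (del i y) = nodes y - 1"
  by (induction y arbitrary: i) (auto simp: leaves_eq_nodes)

lemma del_in_Y: "y \<in> Y (Suc n) \<Longrightarrow> i \<le> Suc n \<Longrightarrow> del i y \<in> Y n"
  by (simp add: Y_def)

lemma del_eq_Leaf_iff: "i \<le> nodes y \<Longrightarrow> del i y = Leaf \<longleftrightarrow> nodes y \<le> 1"
  using nodes_del [of i y] nodes_eq_0_iff [of "del i y"] by linarith

text \<open>Deleting a leaf can reorient a remaining leaf only by removing its entire sibling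
  subtree, which must then be a single neighbouring leaf. The bound on \<open>j\<close> keeps it
  away from the neighbours of \<open>i\<close>.\<close>

lemma is_left_child_del_right:
  "i + 1 < j \<Longrightarrow> j \<le> nodes y \<Longrightarrow> is_left_child i (del j y) = is_left_child i y"
proof (induction y arbitrary: i j)
  case (Graft l r)
  \<comment> \<open>The shortened subtree has at least two vertices, so it does not shrink to a leaf
    and the test at the root keeps its value.\<close>
  have l: "del j l \<noteq> Leaf" if "j \<le> nodes l"
    using that Graft.prems del_eq_Leaf_iff[of j l] by auto
  have r: "del (j - leaves l) r \<noteq> Leaf" if "j \<ge> leaves l" "i \<ge> leaves l"
    using that Graft.prems del_eq_Leaf_iff[of "j - leaves l" r] by (auto simp: leaves_eq_nodes)
  show ?case
    using Graft l r by (auto simp: leaves_eq_nodes)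
qed simp

text \<open>The same sibling argument from the other side; labels to the right of the deleted leaf
  drop by one, hence \<open>i - 1\<close>.\<close>

lemma is_left_child_del_left:
  "j + 1 < i \<Longrightarrow> i \<le> nodes y \<Longrightarrow> is_left_child (i - 1) (del j y) = is_left_child i y"
proof (induction y arbitrary: i j)
  case (Graft l r)
  have l: "del j l \<noteq> Leaf" if "i \<le> nodes l"
    using that Graft.prems del_eq_Leaf_iff[of j l] by auto
  have r: "del (j - leaves l) r \<noteq> Leaf" if "j \<ge> leaves l"
    using that Graft.prems del_eq_Leaf_iff[of "j - leaves l" r] by (auto simp: leaves_eq_nodes)
  show ?case
  proof (cases "i \<le> nodes l")
    case True
    then show ?thesis using Graft l by (auto simp: leaves_eq_nodes)
  next
    case False
    show ?thesis
    proof (cases "j \<le> nodes l")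
      case True
      then show ?thesis using False Graft.prems by (auto simp: leaves_eq_nodes)
    next
      case jF: False
      have "is_left_child (i - leaves l - 1) (del (j - leaves l) r) = is_left_child (i - leaves l) r"
        using jF Graft.prems by (intro Graft.IH) (auto simp: leaves_eq_nodes)
      then show ?thesis using False jF Graft.prems r by (auto simp: leaves_eq_nodes)
    qed
  qed
qed simp

text \<open>Leaf \<open>i + 1\<close> is kept throughout, so no deletion touches a neighbour of leaf
  \<open>i\<close>.\<close>

lemma del_leaves_right:
  "1 \<le> i \<Longrightarrow> y \<in> Y (i + Suc k) \<Longrightarrow>
    del_leaves [i + 2..<i + 2 + k] y \<in> Y (i + 1) \<and>
    is_left_child i (del_leaves [i + 2..<i + 2 + k] y) = is_left_child i y"
proof (induction k arbitrary: y)
  case (Suc k)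
  let ?j = "i + 2 + k"
  have "del_leaves [i + 2..<i + 2 + Suc k] y = del_leaves [i + 2..<?j] (del ?j y)"
    by (simp add: del_leaves_def)
  moreover have "del ?j y \<in> Y (i + Suc k)"
    using Suc.prems by (intro del_in_Y) auto
  moreover have "is_left_child i (del ?j y) = is_left_child i y"
    using Suc.prems by (intro is_left_child_del_right) (auto simp: Y_def)
  ultimately show ?case using Suc by simp
qed (simp add: del_leaves_def)

text \<open>The leaf followed keeps its left neighbour \<open>k\<close>, and each deletion lowers
  its label by one until it is the middle leaf of a tree in \<open>Y 2\<close>.\<close>

lemma del_leaves_left:
  "y \<in> Y (k + 2) \<Longrightarrow>
    del_leaves [0..<k] y \<in> Y 2 \<and>
    is_left_child 1 (del_leaves [0..<k] y) = is_left_child (k + 1) y"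
proof (induction k arbitrary: y)
  case (Suc k)
  have "del_leaves [0..<Suc k] y = del_leaves [0..<k] (del k y)"
    by (simp add: del_leaves_def)
  moreover have "del k y \<in> Y (k + 2)"
    using Suc.prems by (intro del_in_Y) auto
  moreover have "is_left_child (k + 1) (del k y) = is_left_child (Suc k + 1) y"
    using Suc.prems is_left_child_del_left[of k "Suc k + 1" y] by (auto simp: Y_def)
  ultimately show ?case using Suc by simp
qed (simp add: del_leaves_def numeral_2_eq_2)

section \<open>The maps \<open>R_inner\<close> and \<open>R_outer\<close> when one factor has arity
  two\<close>

lemma R_inner_2:
  assumes "y \<in> Y (n + 1)" "1 \<le> i" "i \<le> n"
  shows "R_inner n i 2 y = (if star i y = Dashv then y_dashv else y_vdash)"
proof -
  let ?z = "del_leaves [i + 2..<n + 2] y"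
  \<comment> \<open>\<open>k\<close> and \<open>j\<close> count the leaves removed to the right of
    leaf \<open>i + 1\<close> and to the left of leaf \<open>i - 1\<close>.\<close>
  obtain k where n: "n = i + k" using assms(3) le_Suc_ex by blast
  obtain j where i: "i = j + 1" using assms(2) by (metis le_add_diff_inverse2)
  have z: "?z \<in> Y (j + 2)" "is_left_child i ?z = is_left_child i y"
    using del_leaves_right[of i y k] assms by (auto simp: n i add.commute add.left_commute)
  have R: "R_inner n i 2 y = del_leaves [0..<j] ?z"
    by (simp add: R_inner_def del_leaves_def i)
  have "R_inner n i 2 y \<in> Y 2" "is_left_child 1 (R_inner n i 2 y) = is_left_child i y"
    unfolding R using del_leaves_left[OF z(1)] z(2) by (simp_all add: i)
  moreover have "star i y = (if is_left_child i y then Dashv else Vdash)"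
    using assms by (auto simp: star_def Y_def)
  \<comment> \<open>A tree in \<open>Y 2\<close> is determined by the orientation of its middle
    leaf, here leaf \<open>i\<close> of \<open>y\<close>.\<close>
  ultimately show ?thesis
    using nodes_eq_2_iff[of "R_inner n i 2 y"] by (auto simp: Y_def y_dashv_def y_vdash_def)
qed

lemma R_outer_2: "R_outer n i 2 y = del i y"
  by (simp add: R_outer_def del_leaves_def)

lemma R_inner_2_1: "R_inner 2 1 n y = del (n + 1) y"
  by (simp add: R_inner_def del_leaves_def)

lemma R_inner_2_2: "R_inner 2 2 n y = del 0 y"
  by (simp add: R_inner_def del_leaves_def)

text \<open>Within these bounds the root survives, and a left subtree could shrink to a leaf only by
  losing leaf 0 or leaf 1.\<close>

lemma del_middle_left_Leaf_iff:
  "y \<in> Y (n + 1) \<Longrightarrow> 1 < j \<Longrightarrow> j \<le> n \<Longrightarrow> (\<exists>r. del j y = Graft Leaf r) = (\<exists>r. y = Graft Leaf r)"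
  by (cases y) (auto simp: Y_def leaves_eq_nodes del_eq_Leaf_iff)

lemma del_middle_right_Leaf_iff:
  "y \<in> Y (n + 1) \<Longrightarrow> 0 < j \<Longrightarrow> j < n \<Longrightarrow> (\<exists>l. del j y = Graft l Leaf) = (\<exists>l. y = Graft l Leaf)"
  by (cases y) (auto simp: Y_def leaves_eq_nodes del_eq_Leaf_iff)

text \<open>The kept leaves are 0, \<open>n\<close> and \<open>n + 1\<close>. Whether the last leaf
  hangs at the root is preserved by each deletion, and it decides both the remaining tree in
  \<open>Y 2\<close> and the last star symbol.\<close>

lemma R_outer_2_1:
  assumes "y \<in> Y (n + 1)" "1 \<le> n"
  shows "R_outer 2 1 n y = (if star (n + 1) y = Vdash then y_vdash else y_dashv)"
proof -
  have "del_leaves [1..<n] y \<in> Y 2 \<and>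
      (\<exists>l. del_leaves [1..<n] y = Graft l Leaf) = (\<exists>l. y = Graft l Leaf)"
    using assms(2,1)
  proof (induction n arbitrary: y rule: dec_induct)
    case (step n)
    have "del_leaves [1..<Suc n] y = del_leaves [1..<n] (del n y)"
      using step.hyps by (simp add: del_leaves_def)
    moreover have "del n y \<in> Y (n + 1)"
      using step.prems by (simp add: Y_def)
    ultimately show ?case
      using step.IH[of "del n y"] del_middle_right_Leaf_iff[of y "Suc n" n] step.hyps step.prems
      by simp
  qed (auto simp: del_leaves_def numeral_2_eq_2)
  then show ?thesis
    using assms nodes_eq_2_iff[of "del_leaves [1..<n] y"]
    by (auto simp: R_outer_def star_def Y_def y_dashv_def y_vdash_def)
qed

text \<open>Mirror image: the kept leaves are 0, 1 and \<open>n + 1\<close>, and the invariant is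
  whether leaf 0 hangs at the root.\<close>

lemma R_outer_2_2:
  assumes "y \<in> Y (n + 1)" "1 \<le> n"
  shows "R_outer 2 2 n y = (if star 0 y = Dashv then y_dashv else y_vdash)"
proof -
  have "del_leaves [2..<n + 1] y \<in> Y 2 \<and>
      (\<exists>r. del_leaves [2..<n + 1] y = Graft Leaf r) = (\<exists>r. y = Graft Leaf r)"
    using assms(2,1)
  proof (induction n arbitrary: y rule: dec_induct)
    case (step n)
    have "del_leaves [2..<Suc n + 1] y = del_leaves [2..<n + 1] (del (Suc n) y)"
      using step.hyps by (simp add: del_leaves_def)
    moreover have "del (Suc n) y \<in> Y (n + 1)"
      using step.prems by (simp add: Y_def)
    ultimately show ?case
      using step.IH[of "del (Suc n) y"] del_middle_left_Leaf_iff[of y "Suc n" "Suc n"] step.hyps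
        step.prems
      by simp
  qed (auto simp: del_leaves_def numeral_2_eq_2)
  then show ?thesis
    using assms nodes_eq_2_iff[of "del_leaves [2..<n + 1] y"]
    by (auto simp: R_outer_def star_def Y_def y_dashv_def y_vdash_def)
qed

subsection \<open>The differential of the operator\<close>

text \<open>The index counts arguments from one, as in the differential, while list positions count
  from zero.\<close>

definition merge :: "('m \<Rightarrow> 'm \<Rightarrow> 'm) \<Rightarrow> nat \<Rightarrow> 'm list \<Rightarrow> 'm list" where
  "merge op i us = take (i - 1) us @ [op (us ! (i - 1)) (us ! i)] @ drop (i + 1) us"

lemma length_merge [simp]: "1 \<le> i \<Longrightarrow> i < length us \<Longrightarrow> length (merge op i us) = length us - 1"
  by (simp add: merge_def)

lemma merge_1 [simp]: "merge op (Suc 0) (u # v # us) = op u v # us"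
  by (simp add: merge_def)

lemma merge_Cons [simp]: "1 \<le> i \<Longrightarrow> merge op (Suc i) (u # us) = u # merge op i us"
  by (cases i) (auto simp: merge_def)

lemma merge_snoc: "1 \<le> i \<Longrightarrow> i < length us \<Longrightarrow> merge op i (us @ [w]) = merge op i us @ [w]"
  by (auto simp: merge_def nth_append)

lemma merge_last:
  "length us = Suc n \<Longrightarrow> merge op (Suc n) (us @ [w]) = take n us @ [op (us ! n) w]"
  by (simp add: merge_def nth_append)

text \<open>Stated for an arbitrary linear map, to be instantiated at \<open>P\<close>, at the
  multiplication and at both actions.\<close>

lemma linear_simps:
  assumes "Vector_Spaces.linear s t f"
  shows "f (x + y) = f x + f y" "f 0 = 0" "f (- x) = - f x" "f (x - y) = f x - f y"
    "f (s c x) = t c (f x)" "f (sum g S) = (\<Sum>i\<in>S. f (g i))"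
proof -
  interpret module_hom s t f
    using assms by (simp add: module_hom_iff_linear)
  show "f (x + y) = f x + f y" "f 0 = 0" "f (- x) = - f x" "f (x - y) = f x - f y"
    "f (s c x) = t c (f x)" "f (sum g S) = (\<Sum>i\<in>S. f (g i))"
    by (simp_all add: add zero neg diff scale sum)
qed

lemma sum_cochain_apply: "(\<Sum>i\<in>S. F i) y us = (\<Sum>i\<in>S. F i y us)"
  for F :: "'i \<Rightarrow> ('d, 'e::ab_group_add) cochain"
  by (induction S rule: infinite_finite_induct) auto

lemma sum_Suc_0_first: "(\<Sum>i = Suc 0..Suc n. g i) = g (Suc 0) + (\<Sum>i = Suc 0..n. g (Suc i))"
  for g :: "nat \<Rightarrow> 'v::comm_monoid_add"
  by (simp add: sum.atLeast_Suc_atMost sum.shift_bounds_cl_Suc_ivl del: sum.cl_ivl_Suc)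

context rel_averaging_operator
begin

abbreviation "iop \<equiv> induced_op lact ract P"

lemmas vs_simps [simp] =
  vector_space.vector_space_assms[OF vector_space_A]
  vector_space.vector_space_assms[OF vector_space_M]
  linear_simps[OF P_linear]
  linear_simps[OF mult_linear_left] linear_simps[OF mult_linear_right]
  linear_simps[OF lact_linear_left] linear_simps[OF lact_linear_right]
  linear_simps[OF ract_linear_left] linear_simps[OF ract_linear_right]

sublocale A: vector_space sA by (rule vector_space_A)
sublocale M: vector_space sM by (rule vector_space_M)

abbreviation "sAM \<equiv> sum_scale sA sM"
abbreviation "Del \<equiv> Delta mA lact ract"

text \<open>The diassociative differential with coefficients in \<open>A\<close>: both actions of an
  element \<open>u\<close> of \<open>M\<close> on \<open>A\<close> are multiplication by
  \<open>P u\<close>, so the two outer terms carry no star symbol.\<close>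

definition delta_A :: "nat \<Rightarrow> ('m, 'a) cochain \<Rightarrow> ('m, 'a) cochain" where
  "delta_A n f y us =
     mA (P (us ! 0)) (f (del 0 y) (drop 1 us))
     + (\<Sum>i = 1..n. sA ((-1) ^ i) (f (del i y) (merge (iop (star i y)) i us)))
     + sA ((-1) ^ (n + 1)) (mA (f (del (n + 1) y) (take n us)) (P (us ! n)))"

text \<open>
  In degree \<open>n = 0\<close> the tree \<open>| \<or> |\<close> has both shapes, and the sum of the two parts is the commutator
  that defines \<open>\<Theta>\<^sub>0\<close>. The splitting makes a separate treatment of \<open>n = 0\<close> unnecessary.
\<close>

definition Theta_left :: "nat \<Rightarrow> ('m, 'a) cochain \<Rightarrow> ('m, 'm) cochain" where
  "Theta_left n f y us =
     (if y \<in> Y (n + 1) \<and> length us = n + 1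
      then (case y of Graft Leaf r \<Rightarrow> sM ((-1) ^ (n + 1)) (ract (us ! 0) (f r (drop 1 us))) | _ \<Rightarrow> 0)
      else 0)"

definition Theta_right :: "nat \<Rightarrow> ('m, 'a) cochain \<Rightarrow> ('m, 'm) cochain" where
  "Theta_right n f y us =
     (if y \<in> Y (n + 1) \<and> length us = n + 1
      then (case y of Graft l Leaf \<Rightarrow> lact (f l (take n us)) (us ! n) | _ \<Rightarrow> 0)
      else 0)"

lemma Theta_eq: "Theta sM lact ract n f = Theta_left n f + Theta_right n f"
proof (intro ext)
  fix y us
  show "Theta sM lact ract n f y us = (Theta_left n f + Theta_right n f) y us"
  proof (cases "n = 0")
    case True
    then show ?thesis
      by (auto simp: Theta_def Theta_left_def Theta_right_def cochain1_def Y_def nodes_eq_1_iff Let_def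
        algebra_simps)
  next
    \<comment> \<open>In positive degree a tree cannot have both shapes, so at most one summand is
      nonzero.\<close>
    case False
    then show ?thesis
      by (auto simp: Theta_def Theta_left_def Theta_right_def Y_def split: ytree.splits)
  qed
qed

text \<open>Three insertions contribute: \<open>P\<close> in either argument of \<open>Delta\<close>
  and, with a minus sign, \<open>Delta\<close> in \<open>P\<close>. The second component is the
  product of \<open>M_P\<close>; the subtracted term is the source of the correction by
  \<open>P\<close> after \<open>Theta\<close>.\<close>

lemma MM_Delta_P_dashv:
  "MM_bracket sAM 2 1 Del (ext_cochain (cochain1 P)) y_dashv [(a, u), (b, v)]
   = (mA (P u) b + mA a (P v) - P (ract u b), ract u (P v))"
  by (simp add: MM_bracket_def circ_i_def cochain_scale_def sum_scale_def Delta_def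
    ext_cochain_def cochain1_def R_outer_def R_inner_def del_leaves_def
    y_dashv_def y_vdash_def Y_def numeral_2_eq_2 zero_prod_def)

lemma MM_Delta_P_vdash:
  "MM_bracket sAM 2 1 Del (ext_cochain (cochain1 P)) y_vdash [(a, u), (b, v)]
   = (mA (P u) b + mA a (P v) - P (lact a v), lact (P u) v)"
  by (simp add: MM_bracket_def circ_i_def cochain_scale_def sum_scale_def Delta_def
    ext_cochain_def cochain1_def R_outer_def R_inner_def del_leaves_def
    y_dashv_def y_vdash_def Y_def numeral_2_eq_2 zero_prod_def)

end

section \<open>Star symbols of trees with a leaf at the root\<close>

lemma star_Graft_Leaf:
  assumes "y = Graft Leaf r" "r \<noteq> Leaf"
  shows "star 0 y = Dashv" "star (Suc 0) y = Dashv" "star (nodes y) y = Dashv"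
    "1 \<le> i \<Longrightarrow> i < nodes r \<Longrightarrow> star (Suc i) y = star i r"
proof -
  \<comment> \<open>Leaf 1 of \<open>y\<close> is the leftmost leaf of \<open>r\<close>, which is
    always a left child.\<close>
  have "is_left_child 0 r" if "r \<noteq> Leaf" for r
    using that by (induction r) (auto simp: leaves_eq_nodes)
  then show "star 0 y = Dashv" "star (Suc 0) y = Dashv" "star (nodes y) y = Dashv"
    "1 \<le> i \<Longrightarrow> i < nodes r \<Longrightarrow> star (Suc i) y = star i r"
    using assms by (auto simp: star_def)
qed

lemma star_Graft_right_Leaf:
  assumes "y = Graft l Leaf" "l \<noteq> Leaf"
  shows "star 0 y = Vdash" "star (nodes l) y = Vdash" "star (nodes y) y = Vdash"
    "1 \<le> i \<Longrightarrow> i < nodes l \<Longrightarrow> star i y = star i l"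
proof -
  \<comment> \<open>Leaf \<open>nodes l\<close> of \<open>y\<close> is the rightmost leaf of
    \<open>l\<close>, which is never a left child.\<close>
  have "\<not> is_left_child (nodes l) l" for l
    by (induction l) (auto simp: leaves_eq_nodes)
  then show "star 0 y = Vdash" "star (nodes l) y = Vdash" "star (nodes y) y = Vdash"
    "1 \<le> i \<Longrightarrow> i < nodes l \<Longrightarrow> star i y = star i l"
    using assms by (auto simp: star_def leaves_eq_nodes)
qed

context rel_averaging_operator
begin

section \<open>Evaluation of the derived bracket\<close>

lemma delta_eq:
  "delta_Diass sM iop n f y us =
    (if y \<in> Y (n + 1) \<and> length us = n + 1
     then iop (star 0 y) (us ! 0) (f (del 0 y) (drop 1 us))
        + (\<Sum>i = 1..n. sM ((-1) ^ i) (f (del i y) (merge (iop (star i y)) i us)))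
        + sM ((-1) ^ (n + 1)) (iop (star (n + 1) y) (f (del (n + 1) y) (take n us)) (us ! n))
     else 0)"
  by (simp add: delta_Diass_def merge_def)

lemma MM_Delta_P:
  assumes "y = y_dashv \<or> y = y_vdash"
  shows "MM_bracket sAM 2 1 Del (ext_cochain (cochain1 P)) y [x, z]
   = (mA (P (snd x)) (fst z) + mA (fst x) (P (snd z))
       - P (if y = y_dashv then ract (snd x) (fst z) else lact (fst x) (snd z)),
      iop (if y = y_dashv then Dashv else Vdash) (snd x) (snd z))"
  using assms MM_Delta_P_dashv[of "fst x" "snd x" "fst z" "snd z"]
    MM_Delta_P_vdash[of "fst x" "snd x" "fst z" "snd z"]
  by (auto simp: induced_op_def y_dashv_def y_vdash_def)


text \<open>An extended cochain reads only \<open>M\<close>-components, so the inserted bracket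
  enters through its second component, the induced product; \<open>R_inner_2\<close> identifies
  which of the two products it is.\<close>

lemma circ_i_ext_MM_Delta_P:
  assumes "y \<in> Y (n + 1)" "length us = n + 1" "1 \<le> i" "i \<le> n"
  shows "circ_i n 2 i (ext_cochain f) (MM_bracket sAM 2 1 Del (ext_cochain (cochain1 P)))
      y (map (Pair 0) us)
    = (f (del i y) (merge (iop (star i y)) i us), 0)"
proof -
  have d: "take 2 (drop (i - 1) us) = [us ! (i - 1), us ! i]"
    using assms by (intro nth_equalityI) (auto simp: less_Suc_eq numeral_2_eq_2)
  have R: "R_inner n i 2 y = (if star i y = Dashv then y_dashv else y_vdash)"
    using assms by (intro R_inner_2) auto
  have s: "(if R_inner n i 2 y = y_dashv then Dashv else Vdash) = star i y"
    by (cases "star i y") (auto simp: R y_dashv_def y_vdash_def)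
  have "MM_bracket sAM 2 1 Del (ext_cochain (cochain1 P)) (R_inner n i 2 y)
      (take 2 (drop (i - 1) (map (Pair 0) us)))
    = MM_bracket sAM 2 1 Del (ext_cochain (cochain1 P)) (R_inner n i 2 y)
      [(0, us ! (i - 1)), (0, us ! i)]"
    by (simp only: drop_map take_map d list.map)
  also have "snd \<dots> = iop (star i y) (us ! (i - 1)) (us ! i)"
    using MM_Delta_P[of "R_inner n i 2 y" "(0, us ! (i - 1))" "(0, us ! i)"] s R by simp
  finally show ?thesis
    using assms
    by (simp add: circ_i_def ext_cochain_def R_outer_2 merge_def drop_map take_map o_def)
qed

text \<open>The inserted value lies in \<open>A\<close> and the last argument in \<open>M\<close>;
  this yields the right outer term of \<open>delta_A\<close> and one part of the correction.\<close>

lemma circ_1_MM_Delta_P_ext: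
  assumes "y \<in> Y (n + 1)" "length us = n + 1" "1 \<le> n"
  shows "fst (circ_i 2 n 1 (MM_bracket sAM 2 1 Del (ext_cochain (cochain1 P))) (ext_cochain f)
      y (map (Pair 0) us))
    = mA (f (del (n + 1) y) (take n us)) (P (us ! n)) - P (Theta_right n f y us)"
proof -
  have d: "drop n us = [us ! n]"
    using assms by (intro nth_equalityI) auto
  have s: "(if R_outer 2 1 n y = y_dashv then Dashv else Vdash) = star (n + 1) y"
    using R_outer_2_1[OF assms(1,3)] by (cases "star (n + 1) y") (auto simp: y_dashv_def y_vdash_def)
  have "circ_i 2 n 1 (MM_bracket sAM 2 1 Del (ext_cochain (cochain1 P))) (ext_cochain f)
      y (map (Pair 0) us)
    = MM_bracket sAM 2 1 Del (ext_cochain (cochain1 P)) (R_outer 2 1 n y)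
        [(f (del (n + 1) y) (take n us), 0), (0, us ! n)]"
    using assms
    by (simp add: circ_i_def ext_cochain_def[of f] R_inner_2_1[simplified] drop_map take_map o_def d)
  also have "fst \<dots> = mA (f (del (n + 1) y) (take n us)) (P (us ! n))
      - P (if star (n + 1) y = Dashv then 0 else lact (f (del (n + 1) y) (take n us)) (us ! n))"
    using MM_Delta_P[of "R_outer 2 1 n y" "(f (del (n + 1) y) (take n us), 0)" "(0, us ! n)"]
      R_outer_2_1[OF assms(1,3)] s by (auto split: if_splits)
  \<comment> \<open>The symbol is \<open>Vdash\<close> exactly when \<open>y = Graft l Leaf\<close>,
    and deleting the last leaf then leaves \<open>l\<close>.\<close>
  also have "(if star (n + 1) y = Dashv then 0 else lact (f (del (n + 1) y) (take n us)) (us ! n))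
      = Theta_right n f y us"
    using assms
    by (cases y) (auto simp: star_def Theta_right_def Y_def leaves_eq_nodes split: ytree.splits)
  finally show ?thesis .
qed

lemma circ_2_MM_Delta_P_ext:
  assumes "y \<in> Y (n + 1)" "length us = n + 1" "1 \<le> n"
  shows "fst (circ_i 2 n 2 (MM_bracket sAM 2 1 Del (ext_cochain (cochain1 P))) (ext_cochain f)
      y (map (Pair 0) us))
    = mA (P (us ! 0)) (f (del 0 y) (drop 1 us)) - sA ((-1) ^ (n + 1)) (P (Theta_left n f y us))"
proof -
  obtain v vs where us: "us = v # vs"
    using assms by (cases us) auto
  have s: "(if R_outer 2 2 n y = y_dashv then Dashv else Vdash) = star 0 y"
    using R_outer_2_2[OF assms(1,3)] by (cases "star 0 y") (auto simp: y_dashv_def y_vdash_def)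
  have "circ_i 2 n 2 (MM_bracket sAM 2 1 Del (ext_cochain (cochain1 P))) (ext_cochain f)
      y (map (Pair 0) us)
    = MM_bracket sAM 2 1 Del (ext_cochain (cochain1 P)) (R_outer 2 2 n y)
        [(0, us ! 0), (f (del 0 y) (drop 1 us), 0)]"
    using assms
    by (simp add: us circ_i_def ext_cochain_def[of f] R_inner_2_2 drop_map take_map o_def)
  also have "fst \<dots> = mA (P (us ! 0)) (f (del 0 y) (drop 1 us))
      - P (if star 0 y = Vdash then 0 else ract (us ! 0) (f (del 0 y) (drop 1 us)))"
    using MM_Delta_P[of "R_outer 2 2 n y" "(0, us ! 0)" "(f (del 0 y) (drop 1 us), 0)"]
      R_outer_2_2[OF assms(1,3)] s by (auto split: if_splits)
  \<comment> \<open>The sign in front cancels the one built into \<open>Theta_left\<close>.\<close>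
  also have "(if star 0 y = Vdash then 0 else ract (us ! 0) (f (del 0 y) (drop 1 us)))
      = sM ((-1) ^ (n + 1)) (Theta_left n f y us)"
    using assms
    by (cases y; cases "even n") (auto simp: star_def Theta_left_def Y_def split: ytree.splits)
  finally show ?thesis by simp
qed

text \<open>Closed form of \<open>d_P\<close> replacing the nested brackets. In degree 0 it reduces
  to the separate definition, the inner sum being empty.\<close>

lemma d_P_eq:
  "d_P sA mA sM lact ract P n f y us =
    (if y \<in> Y (n + 1) \<and> length us = n + 1
     then sA ((-1) ^ n) (delta_A n f y us) + P (Theta_left n f y us + Theta_right n f y us)
     else 0)"
proof (cases "n = 0")
  case True
  then show ?thesis
    by (auto simp: d_P_def cochain1_def Let_def Y_def nodes_eq_1_iff delta_A_def Theta_left_def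
      Theta_right_def)
next
  case False
  let ?D = "MM_bracket sAM 2 1 Del (ext_cochain (cochain1 P))"
  let ?xs = "map (Pair 0) us"
  \<comment> \<open>The minus sign is the factor \<open>(-1) ^ 1\<close> of the derived bracket, as
    \<open>P\<close> has arity one.\<close>
  have d: "d_P sA mA sM lact ract P n f y us = - fst (MM_bracket sAM 2 n ?D (ext_cochain f) y ?xs)"
    using False
    by (simp add: d_P_def derived_bracket_def restrict_cochain_def cochain_scale_def one_add_one
      del: One_nat_def add_2_eq_Suc add_2_eq_Suc')
  also have "\<dots> = - (fst (circ_i 2 n 1 ?D (ext_cochain f) y ?xs)
      + sA ((-1) ^ (n - 1)) (fst (circ_i 2 n 2 ?D (ext_cochain f) y ?xs))
      - sA ((-1) ^ (n - 1))
          (\<Sum>i = 1..n. sA ((-1) ^ (i - 1)) (fst (circ_i n 2 i (ext_cochain f) ?D y ?xs))))"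
    by (simp add: MM_bracket_def cochain_scale_def sum_cochain_apply sum_scale_def fst_sum numeral_2_eq_2)
  finally have d: "d_P sA mA sM lact ract P n f y us = \<dots>" .
  show ?thesis
  proof (cases "y \<in> Y (n + 1) \<and> length us = n + 1")
    case True
    \<comment> \<open>The bracket counts signs by \<open>i - 1\<close> and the differential by
      \<open>i\<close>, hence one global minus.\<close>
    then have S: "(\<Sum>i = 1..n. sA ((-1) ^ (i - 1)) (fst (circ_i n 2 i (ext_cochain f) ?D y ?xs)))
      = - (\<Sum>i = 1..n. sA ((-1) ^ i) (f (del i y) (merge (iop (star i y)) i us)))"
      unfolding sum_negf[symmetric]
    proof (intro sum.cong refl)
      fix i assume i: "i \<in> {1..n}"
      then obtain j where "i = Suc j" by (cases i) auto
      with i True show "sA ((-1) ^ (i - 1)) (fst (circ_i n 2 i (ext_cochain f) ?D y ?xs))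
        = - sA ((-1) ^ i) (f (del i y) (merge (iop (star i y)) i us))"
        using circ_i_ext_MM_Delta_P[of y n us i f] by simp
    qed
    obtain k where n: "n = Suc k" using False by (cases n) auto
    show ?thesis
      unfolding d S
      using True circ_1_MM_Delta_P_ext[of y n us f] circ_2_MM_Delta_P_ext[of y n us f]
      by (cases "even k") (simp_all add: n delta_A_def)
  next
    case out: False
    then have "circ_i 2 n j ?D (ext_cochain f) y ?xs = 0" "circ_i n 2 j (ext_cochain f) ?D y ?xs = 0"
      for j
      by (auto simp: circ_i_def)
    then show ?thesis
      unfolding d using out by auto
  qed
qed

subsection \<open>Compatibility with the differentials\<close>

lemma Theta_left_Graft_Leaf:
  "nodes r = n \<Longrightarrow> length vs = n \<Longrightarrow>
    Theta_left n f (Graft Leaf r) (u # vs) = sM ((-1) ^ (n + 1)) (ract u (f r vs))"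
  by (simp add: Theta_left_def Y_def)

lemma Theta_left_Graft: "l \<noteq> Leaf \<Longrightarrow> Theta_left n f (Graft l r) us = 0"
  by (auto simp: Theta_left_def split: ytree.splits)

lemma Theta_right_Graft_Leaf:
  "nodes l = n \<Longrightarrow> length vs = n \<Longrightarrow>
    Theta_right n f (Graft l Leaf) (vs @ [w]) = lact (f l vs) w"
  by (auto simp: Theta_right_def Y_def nth_append split: ytree.splits)

lemma Theta_right_Graft: "r \<noteq> Leaf \<Longrightarrow> Theta_right n f (Graft l r) us = 0"
  by (auto simp: Theta_right_def split: ytree.splits)

text \<open>Deleting leaf 0 leaves \<open>r\<close> and gives the part with \<open>P\<close>. All
  other deletions act inside \<open>r\<close>, and associativity \<open>ract_ract\<close> moves
  their outer terms into \<open>ract u\<close>, where they assemble to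
  \<open>delta_A\<close>.\<close>

lemma delta_Theta_left_Graft_Leaf:
  assumes "nodes r = n + 1" "length vs = n + 1"
  shows "delta_Diass sM iop (n + 1) (Theta_left n f) (Graft Leaf r) (u # vs)
    = ract u (P (Theta_left n f r vs) + sA ((-1) ^ n) (delta_A n f r vs))"
proof -
  let ?y = "Graft Leaf r"
  have r: "r \<noteq> Leaf" using assms by auto
  note st = star_Graft_Leaf[OF refl r]
  obtain v ws where vs: "vs = v # ws" using assms by (cases vs) auto
  have del: "del (Suc j) ?y = Graft Leaf (del j r)" for j using r by simp
  \<comment> \<open>Leaf \<open>i + 1\<close> of the whole tree is leaf \<open>i\<close> of
    \<open>r\<close>; the exceptional first and last terms are treated separately.\<close>
  have S: "(\<Sum>i = 1..n. sM ((-1) ^ Suc i)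
        (Theta_left n f (del (Suc i) ?y) (merge (iop (star (Suc i) ?y)) (Suc i) (u # vs))))
      = (\<Sum>i = 1..n. sM ((-1) ^ n) (ract u (sA ((-1) ^ i)
          (f (del i r) (merge (iop (star i r)) i vs)))))"
    using assms r st unfolding del
    by (intro sum.cong refl) (simp add: Theta_left_Graft_Leaf power_add mult.commute)
  have 1: "Theta_left n f (del 1 ?y) (merge (iop (star 1 ?y)) 1 (u # vs))
      = sM ((-1) ^ (n + 1)) (ract (ract u (P v)) (f (del 0 r) ws))"
    using assms r st del[of 0] by (simp add: Theta_left_Graft_Leaf vs induced_op_def)
  have last: "Theta_left n f (del (n + 2) ?y) (take (n + 1) (u # vs))
      = sM ((-1) ^ (n + 1)) (ract u (f (del (n + 1) r) (take n vs)))"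
    using assms r del[of "n + 1"] by (simp add: Theta_left_Graft_Leaf)
  have "delta_Diass sM iop (n + 1) (Theta_left n f) ?y (u # vs)
    = ract u (P (Theta_left n f r vs))
      - sM ((-1) ^ (n + 1)) (ract (ract u (P v)) (f (del 0 r) ws))
      + (\<Sum>i = 1..n. sM ((-1) ^ n) (ract u (sA ((-1) ^ i)
          (f (del i r) (merge (iop (star i r)) i vs)))))
      + sM ((-1) ^ n) (ract (sM ((-1) ^ (n + 1)) (ract u (f (del (n + 1) r) (take n vs)))) (P (vs ! n)))"
  proof -
    have "star 0 ?y = Dashv" "star (n + 2) ?y = Dashv" "del 0 ?y = r" using st assms by auto
    then show ?thesis
      using assms S 1 last unfolding delta_eq
      by (simp add: sum_Suc_0_first Y_def induced_op_def del: del.simps sum.cl_ivl_Suc)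
  qed
  also have "\<dots> = ract u (P (Theta_left n f r vs) + sA ((-1) ^ n) (delta_A n f r vs))"
    by (cases "even n") (simp_all add: delta_A_def vs ract_ract sum_negf)
  finally show ?thesis .
qed

text \<open>A term survives only if the deletion produces a tree with a leaf as left subtree, or
  removes the root by deleting \<open>r = Leaf\<close>. The former leaves only the deletions of
  leaves 0 and 1, which cancel.\<close>

lemma delta_Theta_left_Graft:
  assumes "nodes l + nodes r = n + 1" "length us = n + 2" "l \<noteq> Leaf"
  shows "delta_Diass sM iop (n + 1) (Theta_left n f) (Graft l r) us
    = (if r = Leaf then sM ((-1) ^ n) (lact (P (Theta_left n f l (take (n + 1) us))) (us ! (n + 1)))
       else 0)"
proof -
  let ?y = "Graft l r"
  obtain u v vs where us: "us = u # v # vs" using assms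
    by (metis add_2_eq_Suc' length_Suc_conv)
  have S: "(\<Sum>i = 1..n. sM ((-1) ^ Suc i)
        (Theta_left n f (del (Suc i) ?y) (merge (iop (star (Suc i) ?y)) (Suc i) us))) = 0"
  proof (intro sum.neutral ballI)
    fix i assume i: "i \<in> {1..n}"
    have "Theta_left n f (del (Suc i) ?y) ws = 0" for ws
      using assms i del_eq_Leaf_iff[of "Suc i" l] by (auto simp: Theta_left_Graft leaves_eq_nodes)
    then show "sM ((-1) ^ Suc i)
        (Theta_left n f (del (Suc i) ?y) (merge (iop (star (Suc i) ?y)) (Suc i) us)) = 0" by simp
  qed
  have st: "star 0 ?y = Vdash"
    using assms by (simp add: star_def)
  \<comment> \<open>If \<open>l\<close> has one vertex, both deletions give
    \<open>Graft Leaf r\<close> and the values agree by the bimodule law \<open>lact_ract\<close>;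
    otherwise both vanish.\<close>
  have 01: "lact (P u) (Theta_left n f (del 0 ?y) (v # vs))
      = Theta_left n f (del 1 ?y) (merge (iop (star 1 ?y)) 1 us)"
  proof (cases "nodes l = 1")
    case True
    then have l: "l = Graft Leaf Leaf" using nodes_eq_1_iff by simp
    then have "star 1 ?y = Vdash" using assms by (simp add: star_def)
    then show ?thesis
      using assms by (simp add: us l Theta_left_Graft_Leaf induced_op_def lact_ract)
  next
    case False
    then have "2 \<le> nodes l"
      using assms nodes_eq_0_iff[of l] by linarith
    then have "del 0 l \<noteq> Leaf" "del 1 l \<noteq> Leaf"
      using assms del_eq_Leaf_iff[of 0 l] del_eq_Leaf_iff[of 1 l] by (auto simp: Suc_le_eq)
    then show ?thesis
      using assms False by (simp add: Theta_left_Graft leaves_eq_nodes)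
  qed
  have last: "sM ((-1) ^ n) (iop (star (n + 2) ?y) (Theta_left n f (del (n + 2) ?y) (take (n + 1) us)) (us ! (n + 1)))
      = (if r = Leaf then sM ((-1) ^ n) (lact (P (Theta_left n f l (take (n + 1) us))) (us ! (n + 1)))
       else 0)"
    using assms by (auto simp: star_def Theta_left_Graft leaves_eq_nodes induced_op_def)
  have "?y \<in> Y (n + 2)" using assms by (simp add: Y_def)
  then have "delta_Diass sM iop (n + 1) (Theta_left n f) ?y us
    = lact (P u) (Theta_left n f (del 0 ?y) (v # vs))
      - Theta_left n f (del 1 ?y) (merge (iop (star 1 ?y)) 1 us)
      + sM ((-1) ^ n) (iop (star (n + 2) ?y) (Theta_left n f (del (n + 2) ?y) (take (n + 1) us)) (us ! (n + 1)))"
    using assms S st unfolding delta_eq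
    by (simp add: sum_Suc_0_first us induced_op_def[of _ _ _ Vdash] del: del.simps sum.cl_ivl_Suc)
  then show ?thesis unfolding 01 last by simp
qed

text \<open>Mirror image: deleting the last leaf leaves \<open>l\<close> and gives the part with
  \<open>P\<close>, while the other terms assemble to \<open>delta_A\<close> through
  \<open>lact_lact\<close>.\<close>

lemma delta_Theta_right_Graft_Leaf:
  assumes "nodes l = n + 1" "length vs = n + 1"
  shows "delta_Diass sM iop (n + 1) (Theta_right n f) (Graft l Leaf) (vs @ [w])
    = lact (sA ((-1) ^ n) (P (Theta_right n f l vs)) + delta_A n f l vs) w"
proof -
  let ?y = "Graft l Leaf"
  have l: "l \<noteq> Leaf" using assms by auto
  note st = star_Graft_right_Leaf[OF refl l]
  have del: "del j ?y = Graft (del j l) Leaf" if "j \<le> n + 1" for j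
    using l assms that by (simp add: leaves_eq_nodes)
  have S: "(\<Sum>i = 1..n. sM ((-1) ^ i)
        (Theta_right n f (del i ?y) (merge (iop (star i ?y)) i (vs @ [w]))))
      = (\<Sum>i = 1..n. lact (sA ((-1) ^ i) (f (del i l) (merge (iop (star i l)) i vs))) w)"
    using assms l st
    by (intro sum.cong refl) (simp add: Theta_right_Graft_Leaf merge_snoc del del: del.simps)
  have 0: "Theta_right n f (del 0 ?y) (drop 1 (vs @ [w])) = lact (f (del 0 l) (drop 1 vs)) w"
    using assms del[of 0] by (simp add: Theta_right_Graft_Leaf del: del.simps)
  have n: "Theta_right n f (del (n + 1) ?y) (merge (iop (star (n + 1) ?y)) (n + 1) (vs @ [w]))
      = lact (f (del (n + 1) l) (take n vs)) (lact (P (vs ! n)) w)"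
    using assms l st del[of "n + 1"]
    by (simp add: Theta_right_Graft_Leaf merge_last induced_op_def del: del.simps)
  have last: "del (n + 2) ?y = l" using assms by (simp add: leaves_eq_nodes)
  have "star 0 ?y = Vdash" "star (n + 2) ?y = Vdash" using st assms by auto
  then have "delta_Diass sM iop (n + 1) (Theta_right n f) ?y (vs @ [w])
    = lact (P (vs ! 0)) (lact (f (del 0 l) (drop 1 vs)) w)
      + (\<Sum>i = 1..n. lact (sA ((-1) ^ i) (f (del i l) (merge (iop (star i l)) i vs))) w)
      + sM ((-1) ^ (n + 1)) (lact (f (del (n + 1) l) (take n vs)) (lact (P (vs ! n)) w))
      + sM ((-1) ^ n) (lact (P (Theta_right n f l vs)) w)"
    using assms S 0 n last unfolding delta_eq
    by (simp add: Y_def induced_op_def nth_append del: del.simps)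
  also have "\<dots> = lact (sA ((-1) ^ n) (P (Theta_right n f l vs)) + delta_A n f l vs) w"
    by (simp add: delta_A_def lact_lact)
  finally show ?thesis .
qed

text \<open>Mirror image: the last two deletions cancel, and deleting leaf 0 contributes when it
  removes the root.\<close>

lemma delta_Theta_right_Graft:
  assumes "nodes l + nodes r = n + 1" "length us = n + 2" "r \<noteq> Leaf"
  shows "delta_Diass sM iop (n + 1) (Theta_right n f) (Graft l r) us
    = (if l = Leaf then ract (us ! 0) (P (Theta_right n f r (drop 1 us))) else 0)"
proof -
  let ?y = "Graft l r"
  obtain xs w where xs: "us = xs @ [w]" "length xs = n + 1"
    using assms by (cases us rule: rev_cases) auto
  moreover obtain vs v where "xs = vs @ [v]"
    using xs by (cases xs rule: rev_cases) auto
  ultimately have us: "us = vs @ [v, w]" "length vs = n" by auto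
  have S: "(\<Sum>i = 1..n. sM ((-1) ^ i)
        (Theta_right n f (del i ?y) (merge (iop (star i ?y)) i us))) = 0"
  proof (intro sum.neutral ballI)
    fix i assume i: "i \<in> {1..n}"
    have "Theta_right n f (del i ?y) ws = 0" for ws
      using assms i del_eq_Leaf_iff[of "i - leaves l" r]
      by (auto simp: Theta_right_Graft leaves_eq_nodes)
    then show "sM ((-1) ^ i)
        (Theta_right n f (del i ?y) (merge (iop (star i ?y)) i us)) = 0" by simp
  qed
  have st: "star (n + 2) ?y = Dashv"
    using assms by (simp add: star_def)
  have 01: "ract (Theta_right n f (del (n + 2) ?y) (take (n + 1) us)) (P w)
      = Theta_right n f (del (n + 1) ?y) (merge (iop (star (n + 1) ?y)) (n + 1) us)"
  proof (cases "nodes r = 1")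
    case True
    then have r: "r = Graft Leaf Leaf" using nodes_eq_1_iff by simp
    then have "star (n + 1) ?y = Dashv" using assms by (simp add: star_def leaves_eq_nodes)
    then show ?thesis
      using assms merge_last[of "vs @ [v]" n _ w]
      by (simp add: us r leaves_eq_nodes Theta_right_Graft_Leaf induced_op_def lact_ract nth_append)
  next
    case False
    then have "2 \<le> nodes r"
      using assms nodes_eq_0_iff[of r] by linarith
    then have "del (n + 2 - leaves l) r \<noteq> Leaf" "del (n + 1 - leaves l) r \<noteq> Leaf"
      using assms del_eq_Leaf_iff[of "n + 2 - leaves l" r] del_eq_Leaf_iff[of "n + 1 - leaves l" r]
      by (auto simp: leaves_eq_nodes)
    then show ?thesis
      using assms False by (auto simp: Theta_right_Graft leaves_eq_nodes)
  qed
  have first: "iop (star 0 ?y) (us ! 0) (Theta_right n f (del 0 ?y) (drop 1 us))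
      = (if l = Leaf then ract (us ! 0) (P (Theta_right n f r (drop 1 us))) else 0)"
    using assms by (auto simp: star_def Theta_right_Graft leaves_eq_nodes induced_op_def)
  have "?y \<in> Y (n + 2)" "us ! (n + 1) = w" using assms us by (simp_all add: Y_def nth_append)
  then have "delta_Diass sM iop (n + 1) (Theta_right n f) ?y us
    = iop (star 0 ?y) (us ! 0) (Theta_right n f (del 0 ?y) (drop 1 us))
      + sM ((-1) ^ (n + 1)) (Theta_right n f (del (n + 1) ?y) (merge (iop (star (n + 1) ?y)) (n + 1) us))
      + sM ((-1) ^ n) (ract (Theta_right n f (del (n + 2) ?y) (take (n + 1) us)) (P w))"
    using assms S st unfolding delta_eq
    by (simp add: induced_op_def[of _ _ _ Dashv] del: del.simps)
  then show ?thesis unfolding 01 first by simp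
qed

section \<open>Linearity of the diassociative differential and the intertwining relation\<close>

lemma delta_add:
  "delta_Diass sM iop n (f + g) = delta_Diass sM iop n f + delta_Diass sM iop n g"
proof (intro ext)
  have [simp]: "iop s x (y + z) = iop s x y + iop s x z" "iop s (y + z) x = iop s y x + iop s z x"
    for s x y z
    by (cases s; simp add: induced_op_def)+
  show "delta_Diass sM iop n (f + g) y us = (delta_Diass sM iop n f + delta_Diass sM iop n g) y us"
    for y us
    by (simp add: delta_eq sum.distrib)
qed

lemma delta_scale:
  "delta_Diass sM iop n (cochain_scale sM c f) = cochain_scale sM c (delta_Diass sM iop n f)"
proof (intro ext)
  have [simp]: "iop s x (sM c y) = sM c (iop s x y)" "iop s (sM c y) x = sM c (iop s y x)"
    for s x y
    by (cases s; simp add: induced_op_def)+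
  show "delta_Diass sM iop n (cochain_scale sM c f) y us
    = cochain_scale sM c (delta_Diass sM iop n f) y us" for y us
    by (simp add: delta_eq cochain_scale_def M.scale_sum_right M.scale_right_diff_distrib mult.commute)
qed

text \<open>The halves must be taken together: on a tree with a leaf at the root, the half of
  matching shape yields \<open>delta_A\<close> and its own part of the correction, and the other
  half supplies the remaining part.\<close>

lemma delta_Theta:
  "delta_Diass sM iop (n + 1) (Theta sM lact ract n f)
    = cochain_scale sM ((-1) ^ n) (Theta sM lact ract (n + 1) (d_P sA mA sM lact ract P n f))"
proof (intro ext)
  fix y us
  let ?d = "d_P sA mA sM lact ract P n f"
  let ?L = "delta_Diass sM iop (n + 1) (Theta_left n f) y us"
  let ?R = "delta_Diass sM iop (n + 1) (Theta_right n f) y us"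
  have "?L + ?R = sM ((-1) ^ n) (Theta_left (n + 1) ?d y us + Theta_right (n + 1) ?d y us)"
  proof (cases "y \<in> Y (n + 2) \<and> length us = n + 2")
    case False
    then show ?thesis
      by (auto simp: delta_eq Theta_left_def Theta_right_def)
  next
    case True
    then obtain l r where y: "y = Graft l r" "nodes l + nodes r = n + 1"
      by (cases y) (auto simp: Y_def)
    \<comment> \<open>The first two cases exclude each other, since \<open>l\<close> and
      \<open>r\<close> together have \<open>n + 1\<close> vertices.\<close>
    consider "l = Leaf" | "r = Leaf" | "l \<noteq> Leaf" "r \<noteq> Leaf" by blast
    then show ?thesis
    proof cases
      case 1
      obtain v vs where us: "us = v # vs" using True by (cases us) auto
      have r: "r \<noteq> Leaf" using y 1 by auto
      show ?thesis
        using True y 1 r delta_Theta_left_Graft_Leaf[of r n vs f v]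
          delta_Theta_right_Graft[of l r n us f]
        by (auto simp: us Theta_left_Graft_Leaf Theta_right_Graft d_P_eq Y_def algebra_simps)
    next
      case 2
      obtain vs v where us: "us = vs @ [v]" using True by (cases us rule: rev_cases) auto
      have l: "l \<noteq> Leaf" using y 2 by auto
      show ?thesis
        using True y 2 l delta_Theta_right_Graft_Leaf[of l n vs f v]
          delta_Theta_left_Graft[of l r n us f]
        by (auto simp: us Theta_right_Graft_Leaf Theta_left_Graft d_P_eq Y_def nth_append
          algebra_simps)
    next
      case 3
      then show ?thesis
        using True y delta_Theta_left_Graft[of l r n us f] delta_Theta_right_Graft[of l r n us f]
        by (auto simp: Theta_left_Graft Theta_right_Graft)
    qed
  qed
  then show "delta_Diass sM iop (n + 1) (Theta sM lact ract n f) y us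
    = cochain_scale sM ((-1) ^ n) (Theta sM lact ract (n + 1) ?d) y us"
    by (simp add: Theta_eq delta_add cochain_scale_def)
qed

end

subsection \<open>Passage to cohomology\<close>

definition lin_closed :: "('k \<Rightarrow> 'v \<Rightarrow> 'v) \<Rightarrow> 'v::monoid_add set \<Rightarrow> bool" where
  "lin_closed s B \<longleftrightarrow> 0 \<in> B \<and> (\<forall>x\<in>B. \<forall>y\<in>B. x + y \<in> B) \<and> (\<forall>c. \<forall>x\<in>B. s c x \<in> B)"

lemma lin_closedD:
  assumes "lin_closed s B"
  shows "0 \<in> B" "x \<in> B \<Longrightarrow> y \<in> B \<Longrightarrow> x + y \<in> B" "x \<in> B \<Longrightarrow> s c x \<in> B"
  using assms by (auto simp: lin_closed_def)

text \<open>The induced map is defined on cosets as sets, so no representative is chosen: adding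
  \<open>B'\<close> enlarges the image of \<open>f +o B\<close> to a full coset of
  \<open>B'\<close>, and \<open>T\<close> mapping \<open>B\<close> into \<open>B'\<close> prevents
  anything larger.\<close>

lemma linear_between_coset_map:
  fixes s :: "'k \<Rightarrow> 'v::ab_group_add \<Rightarrow> 'v" and s' :: "'k \<Rightarrow> 'w::ab_group_add \<Rightarrow> 'w"
  assumes s: "\<And>c x y. s c (x + y) = s c x + s c y"
    and s': "\<And>c x y. s' c (x + y) = s' c x + s' c y"
    and Z: "lin_closed s Z" and B: "lin_closed s B" and B': "lin_closed s' B'"
    and T: "\<And>x y. T (x + y) = T x + T y" "\<And>c x. T (s c x) = s' c (T x)"
    and TZ: "T ` Z \<subseteq> Z'" and TB: "T ` B \<subseteq> B'"
  shows "linear_between (quot_scale s B) ((\<lambda>f. f +o B) ` Z)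
           (quot_scale s' B') ((\<lambda>f. f +o B') ` Z') (\<lambda>X. T ` X + B')"
    and "T ` (f +o B) + B' = T f +o B'"
proof -
  note B = lin_closedD[OF B] and B' = lin_closedD[OF B']
  show coset: "T ` (f +o B) + B' = T f +o B'" for f
  proof
    show "T ` (f +o B) + B' \<subseteq> T f +o B'"
      using TB B'(2) by (fastforce simp: elt_set_plus_def set_plus_def T(1) add.assoc)
    show "T f +o B' \<subseteq> T ` (f +o B) + B'"
      using B(1) by (force simp: elt_set_plus_def set_plus_def)
  qed
  show "linear_between (quot_scale s B) ((\<lambda>f. f +o B) ` Z)
      (quot_scale s' B') ((\<lambda>f. f +o B') ` Z') (\<lambda>X. T ` X + B')"
    unfolding linear_between_def
  proof (intro conjI ballI allI)
    fix X assume "X \<in> (\<lambda>f. f +o B) ` Z"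
    then obtain f where f: "f \<in> Z" "X = f +o B" by auto
    show "T ` X + B' \<in> (\<lambda>f. f +o B') ` Z'"
      using f TZ by (auto simp: coset)
    show "T ` quot_scale s B c X + B' = quot_scale s' B' c (T ` X + B')" for c
      using quot_scale_coset[of B s c f] quot_scale_coset[of B' s' c "T f"] B B' s s'
      by (simp add: f coset T)
    fix X' assume "X' \<in> (\<lambda>f. f +o B) ` Z"
    then obtain f' where f': "X' = f' +o B" by auto
    show "T ` (X + X') + B' = (T ` X + B') + (T ` X' + B')"
      using coset_plus_coset[of B f f'] coset_plus_coset[of B' "T f" "T f'"] B B'
      by (simp add: f f' coset T)
  qed
qed

section \<open>Cochain spaces and linearity of \<open>Theta\<close> and \<open>d_P\<close>\<close>

lemma cochains_zero:
  assumes "vector_space s" "vector_space t"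
  shows "0 \<in> cochains s t n"
proof -
  interpret vector_space t by fact
  show ?thesis
    using assms by (auto simp: cochains_def Vector_Spaces.linear_iff)
qed

lemma cochains_add:
  "f \<in> cochains s t n \<Longrightarrow> g \<in> cochains s t n \<Longrightarrow> f + g \<in> cochains s t n"
  by (auto simp: cochains_def Vector_Spaces.linear_iff vector_space.vector_space_assms algebra_simps)

lemma cochains_scale:
  assumes "f \<in> cochains s t n" "vector_space t"
  shows "cochain_scale t c f \<in> cochains s t n"
proof -
  interpret vector_space t by fact
  show ?thesis
    using assms(1)
    by (auto simp: cochains_def cochain_scale_def Vector_Spaces.linear_iff scale_right_distrib mult.commute)
qed

context rel_averaging_operator
begin

lemma Theta_left_cochain:
  assumes "f \<in> cochains sM sA n"
  shows "Theta_left n f \<in> cochains sM sM (n + 1)"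
  unfolding cochains_def
proof (intro CollectI conjI allI impI)
  fix y :: ytree and us :: "'m list" and i
  assume y: "y \<in> Y (n + 1) \<and> length us = n + 1" and i: "i < n + 1"
  then obtain u vs where us: "us = u # vs" by (cases us) auto
  show "Vector_Spaces.linear sM sM (\<lambda>x. Theta_left n f y (us[i := x]))"
  proof (cases "\<exists>r. y = Graft Leaf r")
    case True
    then obtain r where r: "y = Graft Leaf r" "r \<in> Y n" using y by (auto simp: Y_def)
    show ?thesis
    \<comment> \<open>Slot 0 is the element acted upon; slot \<open>Suc j\<close> is slot
      \<open>j\<close> of \<open>f\<close>.\<close>
    proof (cases i)
      case 0
      then show ?thesis
        using y r us by (simp add: Theta_left_Graft_Leaf Y_def Vector_Spaces.linear_iff vector_space_M mult.commute)
    next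
      case (Suc j)
      then have "Vector_Spaces.linear sM sA (\<lambda>x. f r (vs[j := x]))"
        using assms y r us i by (simp add: cochains_def)
      then show ?thesis
        using y r us Suc
        by (simp add: Theta_left_Graft_Leaf Y_def Vector_Spaces.linear_iff mult.commute)
    qed
  next
    case False
    then have "Theta_left n f y us = 0" for us
      by (auto simp: Theta_left_def split: ytree.splits)
    then show ?thesis by (simp add: Vector_Spaces.linear_iff vector_space_M)
  qed
qed (auto simp: Theta_left_def)

lemma Theta_right_cochain:
  assumes "f \<in> cochains sM sA n"
  shows "Theta_right n f \<in> cochains sM sM (n + 1)"
  unfolding cochains_def
proof (intro CollectI conjI allI impI)
  fix y :: ytree and us :: "'m list" and i
  assume y: "y \<in> Y (n + 1) \<and> length us = n + 1" and i: "i < n + 1"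
  then obtain u vs where us: "us = vs @ [u]" by (cases us rule: rev_cases) auto
  show "Vector_Spaces.linear sM sM (\<lambda>x. Theta_right n f y (us[i := x]))"
  proof (cases "\<exists>l. y = Graft l Leaf")
    case True
    then obtain l where l: "y = Graft l Leaf" "l \<in> Y n" using y by (auto simp: Y_def)
    show ?thesis
    proof (cases "i = n")
      case True
      then have "us[i := x] = vs @ [x]" for x
        using y us by (simp add: list_update_append)
      then show ?thesis
        using y l us by (simp add: Theta_right_Graft_Leaf Y_def Vector_Spaces.linear_iff vector_space_M)
    next
      case False
      then have "Vector_Spaces.linear sM sA (\<lambda>x. f l (vs[i := x]))"
        using assms y l us i by (simp add: cochains_def)
      then show ?thesis
        using y l us i False
        by (simp add: list_update_append Theta_right_Graft_Leaf Y_def Vector_Spaces.linear_iff)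
    qed
  next
    case False
    then have "Theta_right n f y us = 0" for us
      by (auto simp: Theta_right_def split: ytree.splits)
    then show ?thesis by (simp add: Vector_Spaces.linear_iff vector_space_M)
  qed
qed (auto simp: Theta_right_def)

lemma Theta_cochain:
  "f \<in> cochains sM sA n \<Longrightarrow> Theta sM lact ract n f \<in> cochains sM sM (n + 1)"
  unfolding Theta_eq by (intro cochains_add Theta_left_cochain Theta_right_cochain)

lemma Theta_add:
  "Theta sM lact ract n (f + g) = Theta sM lact ract n f + Theta sM lact ract n g"
  unfolding Theta_eq
  by (intro ext) (auto simp: Theta_left_def Theta_right_def split: ytree.splits)

lemma Theta_scale:
  "Theta sM lact ract n (cochain_scale sA c f) = cochain_scale sM c (Theta sM lact ract n f)"
  unfolding Theta_eq
  by (intro ext) (auto simp: Theta_left_def Theta_right_def cochain_scale_def mult.commute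
      split: ytree.splits)

lemma Theta_zero: "Theta sM lact ract n 0 = 0"
  using Theta_add[of n 0 0] by simp

text \<open>By the closed form, additivity follows from that of \<open>delta_A\<close>,
  \<open>Theta\<close> and \<open>P\<close>.\<close>

lemma d_P_add:
  "d_P sA mA sM lact ract P n (f + g) = d_P sA mA sM lact ract P n f + d_P sA mA sM lact ract P n g"
proof (intro ext)
  have "P (Theta_left n (f + g) y us + Theta_right n (f + g) y us)
      = P (Theta_left n f y us + Theta_right n f y us)
        + P (Theta_left n g y us + Theta_right n g y us)" for y us
    using fun_cong[OF fun_cong[OF Theta_add[of n f g]], of y us]
    by (simp add: Theta_eq flip: linear_simps(1)[OF P_linear])
  moreover have "delta_A n (f + g) y us = delta_A n f y us + delta_A n g y us" for y us
    by (simp add: delta_A_def sum.distrib)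
  ultimately show "d_P sA mA sM lact ract P n (f + g) y us
      = (d_P sA mA sM lact ract P n f + d_P sA mA sM lact ract P n g) y us" for y us
    by (simp only: d_P_eq plus_fun_apply) (simp add: algebra_simps)
qed

lemma d_P_scale:
  "d_P sA mA sM lact ract P n (cochain_scale sA c f)
    = cochain_scale sA c (d_P sA mA sM lact ract P n f)"
proof (intro ext)
  have "P (Theta_left n (cochain_scale sA c f) y us + Theta_right n (cochain_scale sA c f) y us)
      = sA c (P (Theta_left n f y us + Theta_right n f y us))" for y us
    using fun_cong[OF fun_cong[OF Theta_scale[of n c f]], of y us]
    by (simp add: Theta_eq cochain_scale_def flip: linear_simps(1,5)[OF P_linear])
  moreover have "delta_A n (cochain_scale sA c f) y us = sA c (delta_A n f y us)" for y us
    by (simp add: delta_A_def cochain_scale_def A.scale_sum_right A.scale_right_diff_distrib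
      mult.commute)
  ultimately show "d_P sA mA sM lact ract P n (cochain_scale sA c f) y us
      = cochain_scale sA c (d_P sA mA sM lact ract P n f) y us" for y us
    by (simp add: d_P_eq cochain_scale_def A.scale_right_distrib mult.commute
      del: linear_simps(1)[OF P_linear])
qed

end

section \<open>Subspaces of cochains and the induced map on cohomology\<close>

lemma lin_closed_cochains:
  assumes "vector_space s" "vector_space t"
  shows "lin_closed (cochain_scale t) (cochains s t n)"
  using assms by (auto simp: lin_closed_def cochains_zero cochains_add cochains_scale)

lemma lin_closed_coboundaries:
  fixes C :: "nat \<Rightarrow> 'v::ab_group_add set"
  assumes C: "\<And>n. lin_closed s (C n)" and s: "\<And>c. s c 0 = 0"
    and d: "\<And>n x y. d n (x + y) = d n x + d n y" "\<And>n c x. d n (s c x) = s c (d n x)"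
  shows "lin_closed s (coboundaries C d n)"
proof (cases n)
  case 0
  then show ?thesis using s by (simp add: lin_closed_def coboundaries_def)
next
  case (Suc k)
  have "d k 0 = 0"
    using d(1)[of k 0 0] by simp
  then have "0 \<in> d k ` C k"
    using lin_closedD(1)[OF C[of k]] by force
  then show ?thesis
    using Suc lin_closedD(2,3)[OF C[of k]]
    by (auto simp: lin_closed_def coboundaries_def simp flip: d)
qed

lemma lin_closed_cocycles:
  fixes C :: "nat \<Rightarrow> 'v::ab_group_add set"
  assumes C: "\<And>n. lin_closed s (C n)" and s: "\<And>c. s c 0 = 0"
    and d: "\<And>n x y. d n (x + y) = d n x + d n y" "\<And>n c x. d n (s c x) = s c (d n x)"
  shows "lin_closed s (cocycles C d n)"
proof -
  have "d n 0 = 0"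
    using d(1)[of n 0 0] by simp
  then show ?thesis
    using s lin_closedD[OF C[of n]] by (auto simp: lin_closed_def cocycles_def d)
qed

theorem theorem4p7:
  fixes sA :: "'k::field_char_0 \<Rightarrow> 'a::ab_group_add \<Rightarrow> 'a"
    and mA :: "'a \<Rightarrow> 'a \<Rightarrow> 'a"
    and sM :: "'k \<Rightarrow> 'm::ab_group_add \<Rightarrow> 'm"
    and lact :: "'a \<Rightarrow> 'm \<Rightarrow> 'm"
    and ract :: "'m \<Rightarrow> 'a \<Rightarrow> 'm"
    and P :: "'m \<Rightarrow> 'a"
  assumes "rel_averaging_operator sA mA sM lact ract P"
  shows
    "let CP = cochains sM sA; dP = d_P sA mA sM lact ract P;
         CD = cochains sM sM; dD = delta_Diass sM (induced_op lact ract P);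
         \<Theta> = Theta sM lact ract
     in (\<forall>n. linear_between (cochain_scale sA) (CP n) (cochain_scale sM) (CD (n + 1)) (\<Theta> n)) \<and>
        (\<forall>n. \<Theta> n ` cocycles CP dP n \<subseteq> cocycles CD dD (n + 1)) \<and>
        (\<forall>n. \<Theta> n ` coboundaries CP dP n \<subseteq> coboundaries CD dD (n + 1)) \<and>
        (\<exists>H\<Theta>. \<forall>n.
           linear_between
             (quot_scale (cochain_scale sA) (coboundaries CP dP n)) (cohomology CP dP n)
             (quot_scale (cochain_scale sM) (coboundaries CD dD (n + 1))) (cohomology CD dD (n + 1))
             (H\<Theta> n) \<and>
           (\<forall>f \<in> cocycles CP dP n.
              H\<Theta> n (f +o coboundaries CP dP n) = \<Theta> n f +o coboundaries CD dD (n + 1)))"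
proof -
  interpret rel_averaging_operator sA mA sM lact ract P by fact
  let ?CP = "cochains sM sA" and ?dP = "d_P sA mA sM lact ract P"
    and ?CD = "cochains sM sM" and ?dD = "delta_Diass sM iop" and ?T = "Theta sM lact ract"
  have C: "lin_closed (cochain_scale sA) (?CP n)" "lin_closed (cochain_scale sM) (?CD n)" for n
    by (simp_all add: lin_closed_cochains vector_space_A vector_space_M)
  have scale: "cochain_scale sA c 0 = 0" "cochain_scale sM c 0 = 0"
    "cochain_scale sA c (f + g) = cochain_scale sA c f + cochain_scale sA c g"
    "cochain_scale sM c (f' + g') = cochain_scale sM c f' + cochain_scale sM c g'"
    for c and f g :: "('m, 'a) cochain" and f' g' :: "('m, 'm) cochain"
    by (auto simp: cochain_scale_def fun_eq_iff)
  \<comment> \<open>For a cocycle \<open>f\<close>, the differential of \<open>Theta\<close> at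
    \<open>f\<close> is, up to sign, \<open>Theta\<close> at \<open>d_P f = 0\<close>.\<close>
  have Z: "?T n ` cocycles ?CP ?dP n \<subseteq> cocycles ?CD ?dD (n + 1)" for n
    by (auto simp: cocycles_def Theta_cochain[simplified] delta_Theta[simplified] Theta_zero scale)
  have B: "?T n ` coboundaries ?CP ?dP n \<subseteq> coboundaries ?CD ?dD (n + 1)" for n
  proof (cases n)
    case 0
    have "?dD 0 0 = 0" using delta_add[of 0 0 0] by simp
    then show ?thesis
      using 0 lin_closedD(1)[OF C(2)[of 0]] by (force simp: coboundaries_def Theta_zero)
  next
    case (Suc k)
    have "?T (Suc k) (?dP k f) \<in> ?dD (Suc k) ` ?CD (Suc k)" if "f \<in> ?CP k" for f
    proof
      \<comment> \<open>The preimage carries the sign \<open>(-1) ^ k\<close> of the intertwining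
        relation, which is its own inverse.\<close>
      show "cochain_scale sM ((-1) ^ k) (?T k f) \<in> ?CD (Suc k)"
        using that lin_closedD(3)[OF C(2)] Theta_cochain[of f k] by simp
      show "?T (Suc k) (?dP k f) = ?dD (Suc k) (cochain_scale sM ((-1) ^ k) (?T k f))"
        unfolding delta_scale using delta_Theta[of k f]
        by (simp add: cochain_scale_def flip: power_mult_distrib)
    qed
    then show ?thesis
      using Suc by (auto simp: coboundaries_def)
  qed
  have BP: "lin_closed (cochain_scale sA) (coboundaries ?CP ?dP n)"
    and ZP: "lin_closed (cochain_scale sA) (cocycles ?CP ?dP n)" for n
    using lin_closed_coboundaries[where C = ?CP and d = ?dP, OF C(1) scale(1) d_P_add d_P_scale]
      lin_closed_cocycles[where C = ?CP and d = ?dP, OF C(1) scale(1) d_P_add d_P_scale] by blast+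
  have BD: "lin_closed (cochain_scale sM) (coboundaries ?CD ?dD n)" for n
    using lin_closed_coboundaries[where C = ?CD and d = ?dD, OF C(2) scale(2) delta_add delta_scale] .
  note H = linear_between_coset_map[where s = "cochain_scale sA" and s' = "cochain_scale sM"
      and T = "?T n" for n, OF scale(3,4) ZP BP BD Theta_add Theta_scale Z B]
  show ?thesis
    unfolding Let_def cohomology_def
  proof (intro conjI allI exI ballI)
    show "linear_between (cochain_scale sA) (?CP n) (cochain_scale sM) (?CD (n + 1)) (?T n)" for n
      by (auto simp: linear_between_def Theta_add Theta_scale Theta_cochain[simplified])
  \<comment> \<open>The witness for \<open>H\<Theta>\<close> is the coset map from \<open>H\<close>:
    in each degree, the image of a coset under \<open>Theta\<close> plus the target
    coboundaries.\<close>
  qed (rule Z B H)+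
qed

end
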